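(* Let $p,q\ge 2$ be positive integers. Then the neighbourhood complexes $\mathcal{N}(\mathcal{Q}_{p,q})$ and $\mathcal{N}(\mathcal{K}_{p,q})$ of the $p\times q$ queen graph and the $p\times q$ king graph are simply connected.
   Context: The neighbourhood complex $\mathcal{N}(G)$ of a graph $G$ is the simplicial complex whose simplices are the subsets $\sigma\subseteq V(G)$ whose elements have a common neighbour in $G$. The $m\times n$ queen graph $\mathcal{Q}_{m,n}$ has as vertices the $mn$ squares $(i,j)$, $1\le i\le m$, $1\le j\le n$, of an $m\times n$ chessboard, and its edges correspond to the legal moves of a queen: distinct squares $(i,j)$ and $(k,l)$ are adjacent iff $i=k$, or $j=l$, or $|i-k|=|j-l|$. The $m\times n$ king graph $\mathcal{K}_{m,n}$ has the same vertices, and its edges correspond to the legal moves of a king: distinct squares $(i,j)$ and $(k,l)$ are adjacent iff $|i-k|\le 1$ and $|j-l|\le 1$. Simply connected means that the geometric realization is path connected with trivial fundamental group. *)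

theory Defs
  imports "HOL-Analysis.Analysis" "Graph_Theory.Pair_Digraph"
begin

text \<open>
  Following Graph_Theory, a finite simple graph is a finite, loop-free, symmetric
  pair digraph (locale pair_graph); an edge is represented by both of its orientations.
\<close>

definition queen_graph :: "nat \<Rightarrow> nat \<Rightarrow> (nat \<times> nat) pair_pre_digraph" where
  "queen_graph m n =
    \<lparr> pverts = {1..m} \<times> {1..n},
      parcs = {((i, j), (k, l)). (i, j) \<in> {1..m} \<times> {1..n} \<and> (k, l) \<in> {1..m} \<times> {1..n} \<and>
                (i, j) \<noteq> (k, l) \<and>
                (i = k \<or> j = l \<or> \<bar>int i - int k\<bar> = \<bar>int j - int l\<bar>)} \<rparr>"

definition king_graph :: "nat \<Rightarrow> nat \<Rightarrow> (nat \<times> nat) pair_pre_digraph" where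
  "king_graph m n =
    \<lparr> pverts = {1..m} \<times> {1..n},
      parcs = {((i, j), (k, l)). (i, j) \<in> {1..m} \<times> {1..n} \<and> (k, l) \<in> {1..m} \<times> {1..n} \<and>
                (i, j) \<noteq> (k, l) \<and>
                \<bar>int i - int k\<bar> \<le> 1 \<and> \<bar>int j - int l\<bar> \<le> 1} \<rparr>"

lemma pair_graph_queen_graph: "pair_graph (queen_graph m n)"
proof -
  have "finite (parcs (queen_graph m n))"
    by (rule finite_subset[of _ "({1..m} \<times> {1..n}) \<times> ({1..m} \<times> {1..n})"])
      (auto simp: queen_graph_def)
  then show ?thesis
    by unfold_locales
      (auto simp: queen_graph_def symmetric_def arcs_ends_def arc_to_ends_def sym_def)
qed

lemma pair_graph_king_graph: "pair_graph (king_graph m n)"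
proof -
  have "finite (parcs (king_graph m n))"
    by (rule finite_subset[of _ "({1..m} \<times> {1..n}) \<times> ({1..m} \<times> {1..n})"])
      (auto simp: king_graph_def)
  then show ?thesis
    by unfold_locales
      (auto simp: king_graph_def symmetric_def arcs_ends_def arc_to_ends_def sym_def)
qed

text \<open>
  An abstract simplicial complex is given by its set of simplices. The empty simplex is a
  member; it contributes no point to the geometric realization.
\<close>

definition neighbourhood_complex :: "'a pair_pre_digraph \<Rightarrow> 'a set set" where
  "neighbourhood_complex G =
    {\<sigma>. finite \<sigma> \<and> \<sigma> \<subseteq> pverts G \<and> (\<exists>w \<in> pverts G. \<forall>v \<in> \<sigma>. (v, w) \<in> parcs G)}"

lemma neighbourhood_complex_mono:
  "\<sigma> \<in> neighbourhood_complex G \<Longrightarrow> \<tau> \<subseteq> \<sigma> \<Longrightarrow> \<tau> \<in> neighbourhood_complex G"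
  unfolding neighbourhood_complex_def by (auto intro: finite_subset)

text \<open>
  Points of the geometric realization are given by their barycentric coordinates. As a subset
  of the function type it carries the topology of pointwise convergence, which is the usual
  topology of the realization for complexes with finitely many vertices.
\<close>

definition geometric_realization :: "'a set set \<Rightarrow> ('a \<Rightarrow> real) set" where
  "geometric_realization K =
    {x. (\<forall>v. 0 \<le> x v) \<and> {v. x v \<noteq> 0} \<in> K \<and> (\<Sum>v | x v \<noteq> 0. x v) = 1}"

text \<open>
  The library predicate requires any two loops to be freely homotopic, which includes
  path connectedness, but it also holds for the empty set.
\<close>

definition simply_connected_complex :: "'a set set \<Rightarrow> bool" where
  "simply_connected_complex K \<longleftrightarrow>
    geometric_realization K \<noteq> {} \<and> simply_connected (geometric_realization K)"

end

theory Submission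
  imports Defs
begin

text \<open>
  Cover a simplicial complex by the open stars of its vertices. Choose a path \<open>\<gamma> v\<close> from a base point
  to each vertex \<open>v\<close> such that for every edge \<open>{v, w}\<close> the path \<open>\<gamma> v\<close> followed by the edge is homotopic
  to \<open>\<gamma> w\<close>. Cutting a loop into pieces that each stay in one star then shows that it is
  null-homotopic. Such paths exist if the vertices can be ordered so that each vertex after the
  first has a nonempty connected link in the subcomplex induced by its predecessors. For the two
  neighbourhood complexes the row by row order of the squares works: all squares in the lower link
  of \<open>(i, j)\<close> are joined there to the square above it (in the first row, to the square before it).
\<close>

section \<open>Homotopies of paths in normed spaces\<close>

lemma homotopic_paths_convex:
  fixes p q :: "real \<Rightarrow> 'a::real_normed_vector"
  assumes "convex C" "C \<subseteq> S" "path p" "path q" "path_image p \<subseteq> C" "path_image q \<subseteq> C"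
    and "pathstart q = pathstart p" "pathfinish q = pathfinish p"
  shows "homotopic_paths S p q"
proof (rule homotopic_paths_linear)
  show "closed_segment (p t) (q t) \<subseteq> S" if "t \<in> {0..1}" for t
  proof -
    have "p t \<in> C" "q t \<in> C"
      using assms(5,6) that by (auto simp: path_image_def)
    then show ?thesis
      using assms(1,2) closed_segment_subset by blast
  qed
qed (use assms in auto)

lemma homotopic_paths_triangle:
  fixes a b c :: "'a::real_normed_vector"
  assumes "convex hull {a, b, c} \<subseteq> S"
  shows "homotopic_paths S (linepath a b +++ linepath b c) (linepath a c)"
proof (rule homotopic_paths_convex[OF _ assms])
  have "closed_segment x y \<subseteq> convex hull {a, b, c}" if "x \<in> {a, b, c}" "y \<in> {a, b, c}" for x y
    using that by (meson closed_segment_subset convex_convex_hull hull_inc)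
  then show "path_image (linepath a b +++ linepath b c) \<subseteq> convex hull {a, b, c}"
    "path_image (linepath a c) \<subseteq> convex hull {a, b, c}"
    by (auto simp: path_image_join)
qed auto

text \<open>\<open>F (r, t)\<close> is the point with parameter \<open>r\<close> on the segment from
  \<open>c\<close> to \<open>g t\<close>, so \<open>F\<close> maps the unit square into
  \<open>S\<close>. The two ways round the square are homotopic in it by convexity, and
  \<open>F\<close> carries this homotopy to \<open>S\<close>. Only segments issuing from
  \<open>c\<close> have to lie in \<open>S\<close>, which fits pieces of a loop inside one
  star.\<close>

lemma homotopic_paths_cone:
  fixes g :: "real \<Rightarrow> 'a::real_normed_vector"
  assumes g: "path g" and seg: "\<And>y. y \<in> path_image g \<Longrightarrow> closed_segment c y \<subseteq> S"
  shows "homotopic_paths S (linepath c (pathstart g) +++ g) (linepath c (pathfinish g))"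
proof -
  define F where "F = (\<lambda>(r, t). (1 - r) *\<^sub>R c + r *\<^sub>R g t)"
  let ?I = "{0..1::real} \<times> {0..1::real}"
  have "continuous_on ?I (\<lambda>x. g (snd x))"
    using g unfolding path_def
    by (rule continuous_on_compose2) (auto intro: continuous_on_snd continuous_on_id)
  then have contF: "continuous_on ?I F"
    unfolding F_def case_prod_unfold by (intro continuous_intros)
  have F_in: "F \<in> ?I \<rightarrow> S"
  proof (clarsimp simp: F_def)
    fix r t :: real assume rt: "0 \<le> r" "r \<le> 1" "0 \<le> t" "t \<le> 1"
    then have "g t \<in> path_image g"
      by (auto simp: path_image_def)
    moreover have "(1 - r) *\<^sub>R c + r *\<^sub>R g t \<in> closed_segment c (g t)"
      using rt by (auto simp: in_segment)
    ultimately show "(1 - r) *\<^sub>R c + r *\<^sub>R g t \<in> S"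
      using seg by blast
  qed
  \<comment> \<open>\<open>?p\<close> follows the side \<open>t = 0\<close> and then
    \<open>r = 1\<close>; \<open>?q\<close> follows \<open>r = 0\<close>, where \<open>F\<close> is
    constantly \<open>c\<close>, and then \<open>t = 1\<close>.\<close>
  let ?p = "linepath (0,0) (1,0::real) +++ linepath (1,0) (1,1::real)"
  let ?q = "linepath (0,0) (0,1::real) +++ linepath (0,1) (1,1::real)"
  have conv: "convex ?I"
    by (intro convex_Times) (rule convex_real_interval)+
  have "homotopic_paths ?I ?p ?q"
    by (intro homotopic_paths_convex[OF conv order_refl] subset_path_image_join)
      (auto simp: closed_segment_subset conv simp del: mem_Times_iff)
  then have "homotopic_paths S (F \<circ> ?p) (F \<circ> ?q)"
    using contF F_in by (rule homotopic_paths_continuous_image)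
  moreover have "F \<circ> ?p = linepath c (pathstart g) +++ g"
    by (auto simp: F_def joinpaths_def linepath_def fun_eq_iff pathstart_def)
  moreover have "F \<circ> ?q = linepath c c +++ linepath c (pathfinish g)"
    by (auto simp: F_def joinpaths_def linepath_def fun_eq_iff pathfinish_def algebra_simps)
  moreover have "homotopic_paths S (linepath c c +++ linepath c (pathfinish g)) (linepath c (pathfinish g))"
    using seg[of "pathfinish g"] by (intro homotopic_paths_lid') auto
  ultimately show ?thesis
    using homotopic_paths_trans by metis
qed

text \<open>The detour over \<open>b\<close> is inserted across the triangle, and then
  \<open>p\<close> with the edge is exchanged for \<open>q\<close>. If \<open>y\<close> lies in two
  stars, this compares two routes to \<open>y\<close>; if \<open>y\<close> is a new vertex, it
  changes the neighbour through which \<open>y\<close> is reached.\<close>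

lemma homotopic_paths_slide:
  fixes a b y :: "'a::real_normed_vector"
  assumes p: "path p" "path_image p \<subseteq> S" "pathfinish p = a"
    and pq: "homotopic_paths S (p +++ linepath a b) q" and hull: "convex hull {a, b, y} \<subseteq> S"
  shows "homotopic_paths S (p +++ linepath a y) (q +++ linepath b y)"
proof -
  have seg: "closed_segment a b \<subseteq> S" "closed_segment b y \<subseteq> S"
    using hull by (meson closed_segment_subset convex_convex_hull dual_order.trans hull_inc insertI1 insertI2)+
  have "homotopic_paths S (p +++ linepath a y) (p +++ (linepath a b +++ linepath b y))"
    using p hull by (intro homotopic_paths_join homotopic_paths_sym[OF homotopic_paths_triangle]) auto
  also have "homotopic_paths S \<dots> ((p +++ linepath a b) +++ linepath b y)"
    using p seg by (intro homotopic_paths_assoc) auto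
  also have "homotopic_paths S \<dots> (q +++ linepath b y)"
    using pq seg by (intro homotopic_paths_join) auto
  finally show ?thesis .
qed

text \<open>Cancellation in the fundamental groupoid: prepend the reverse of \<open>p\<close> to
  both sides.\<close>

lemma homotopic_paths_cancel_left:
  fixes p q :: "real \<Rightarrow> 'a::real_normed_vector"
  assumes pq: "homotopic_paths S (p +++ q) p" and p: "path p" "path_image p \<subseteq> S"
    and q: "path q" "path_image q \<subseteq> S" "pathfinish p = pathstart q"
  shows "homotopic_paths S q (linepath (pathstart q) (pathstart q))"
proof -
  let ?r = "reversepath p"
  have "homotopic_paths S q (linepath (pathstart q) (pathstart q) +++ q)"
    using q by (simp add: homotopic_paths_lid homotopic_paths_sym)
  also have "homotopic_paths S \<dots> ((?r +++ p) +++ q)"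
    using homotopic_paths_linv[OF p] p q by (intro homotopic_paths_join) (auto simp: homotopic_paths_sym)
  also have "homotopic_paths S \<dots> (?r +++ (p +++ q))"
    using p q by (intro homotopic_paths_sym[OF homotopic_paths_assoc]) auto
  also have "homotopic_paths S \<dots> (?r +++ p)"
    using p q pq by (intro homotopic_paths_join) auto
  also have "homotopic_paths S \<dots> (linepath (pathstart q) (pathstart q))"
    using homotopic_paths_linv[OF p] q by simp
  finally show ?thesis .
qed

section \<open>Simple connectivity from a cover by stars\<close>

text \<open>\<open>U v\<close> stands for the open star with centre \<open>c v\<close>. For
  \<open>v = w\<close> the hull condition provides the segments from the centre, for distinct ones
  the triangles over which routes are exchanged. Carrying the route to a point of the loop once
  around the loop yields the same route up to homotopy, so the loop cancels.\<close>

lemma simply_connected_star_cover: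
  fixes S :: "'e::real_normed_vector set" and c :: "'v \<Rightarrow> 'e"
  assumes U: "\<And>v. v \<in> V \<Longrightarrow> open (U v)" and cover: "S \<subseteq> (\<Union>v\<in>V. U v)"
    and hull: "\<And>v w y. v \<in> V \<Longrightarrow> w \<in> V \<Longrightarrow> y \<in> S \<Longrightarrow> y \<in> U v \<Longrightarrow> y \<in> U w \<Longrightarrow>
                 convex hull {c v, c w, y} \<subseteq> S"
    and \<gamma>: "\<And>v. v \<in> V \<Longrightarrow> path (\<gamma> v)" "\<And>v. v \<in> V \<Longrightarrow> path_image (\<gamma> v) \<subseteq> S"
      "\<And>v. v \<in> V \<Longrightarrow> pathstart (\<gamma> v) = x0" "\<And>v. v \<in> V \<Longrightarrow> pathfinish (\<gamma> v) = c v"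
    and edge: "\<And>v w. v \<in> V \<Longrightarrow> w \<in> V \<Longrightarrow> S \<inter> U v \<inter> U w \<noteq> {} \<Longrightarrow>
                 homotopic_paths S (\<gamma> v +++ linepath (c v) (c w)) (\<gamma> w)"
  shows "simply_connected S"
proof -
  \<comment> \<open>The route from \<open>x0\<close> to \<open>y\<close> through a star containing
    \<open>y\<close>. By \<open>change\<close> its homotopy class does not depend on the star, and
    by \<open>within\<close> it follows any path inside one star.\<close>
  define \<delta> where "\<delta> v y = \<gamma> v +++ linepath (c v) y" for v y
  have seg: "closed_segment (c v) y \<subseteq> S" if "v \<in> V" "y \<in> S" "y \<in> U v" for v y
    using hull[of v v y] that by (simp add: segment_convex_hull)
  have \<delta>: "path (\<delta> v y)" "path_image (\<delta> v y) \<subseteq> S" "pathstart (\<delta> v y) = x0" "pathfinish (\<delta> v y) = y"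
    if "v \<in> V" "y \<in> S" "y \<in> U v" for v y
    using that \<gamma>[of v] seg[of v y] by (auto simp: \<delta>_def path_image_join)
  have change: "homotopic_paths S (\<delta> v y) (\<delta> w y)"
    if "v \<in> V" "w \<in> V" "y \<in> S" "y \<in> U v" "y \<in> U w" for v w y
    unfolding \<delta>_def using that \<gamma>[of v] edge[of v w] hull[of v w y]
    by (intro homotopic_paths_slide) auto
  have within: "homotopic_paths S (\<delta> v (pathstart g) +++ g) (\<delta> v (pathfinish g))"
    if v: "v \<in> V" and g: "path g" "path_image g \<subseteq> S" "path_image g \<subseteq> U v" for v g
  proof -
    have gseg: "closed_segment (c v) y \<subseteq> S" if "y \<in> path_image g" for y
      using seg v g that by blast
    have "homotopic_paths S (\<delta> v (pathstart g) +++ g) (\<gamma> v +++ (linepath (c v) (pathstart g) +++ g))"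
      unfolding \<delta>_def using \<gamma>[of v] v g gseg[of "pathstart g"]
      by (intro homotopic_paths_sym[OF homotopic_paths_assoc]) auto
    also have "homotopic_paths S \<dots> (\<delta> v (pathfinish g))"
      unfolding \<delta>_def using \<gamma>[of v] v g(1) gseg
      by (intro homotopic_paths_join homotopic_paths_cone) simp_all
    finally show ?thesis .
  qed
  have loop: "homotopic_paths S p (linepath (pathstart p) (pathstart p))"
    if p: "path p" "path_image p \<subseteq> S" "pathfinish p = pathstart p" for p
  proof -
    have pS: "p t \<in> S" if "0 \<le> t" "t \<le> 1" for t
      using p that by (auto simp: path_image_def)
    define P where "P s t \<longleftrightarrow> (0 \<le> s \<longrightarrow> s \<le> t \<longrightarrow> t \<le> 1 \<longrightarrow> (\<forall>v\<in>V. \<forall>w\<in>V. p s \<in> U v \<longrightarrow> p t \<in> U w \<longrightarrow>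
        homotopic_paths S (\<delta> v (p s) +++ subpath s t p) (\<delta> w (p t))))" for s t
    have sub: "path (subpath s t p)" "path_image (subpath s t p) \<subseteq> S" 
      if "0 \<le> s" "s \<le> t" "t \<le> 1" for s t
      using p that by (auto simp: path_image_subpath intro!: path_subpath pS)
    \<comment> \<open>\<open>Bolzano\<close> takes the place of an explicit subdivision:
      \<open>P\<close> is transitive and holds on all short intervals around a given point.\<close>
    have "P 0 1"
      using zero_le_one
    proof (induction rule: Bolzano)
      case (trans a b d)
      show ?case
        unfolding P_def
      proof (intro impI ballI)
        fix v w assume *: "0 \<le> a" "a \<le> d" "d \<le> 1" and vw: "v \<in> V" "w \<in> V" "p a \<in> U v" "p d \<in> U w"
        have "p b \<in> S"
          using pS * trans by auto
        then obtain u where u: "u \<in> V" "p b \<in> U u"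
          using cover by blast
        have ab: "homotopic_paths S (\<delta> v (p a) +++ subpath a b p) (\<delta> u (p b))"
          and bd: "homotopic_paths S (\<delta> u (p b) +++ subpath b d p) (\<delta> w (p d))"
          using trans * vw u by (auto simp: P_def)
        have "homotopic_paths S (\<delta> v (p a) +++ subpath a d p) (\<delta> v (p a) +++ (subpath a b p +++ subpath b d p))"
          using * trans vw p \<delta>[of v "p a"] pS
          by (intro homotopic_paths_join homotopic_paths_sym[OF homotopic_join_subpaths]) auto
        also have "homotopic_paths S \<dots> ((\<delta> v (p a) +++ subpath a b p) +++ subpath b d p)"
          using * trans vw \<delta>[of v "p a"] pS sub by (intro homotopic_paths_assoc) auto
        also have "homotopic_paths S \<dots> (\<delta> u (p b) +++ subpath b d p)"
          using * trans ab sub by (intro homotopic_paths_join) auto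
        also note bd
        finally show "homotopic_paths S (\<delta> v (p a) +++ subpath a d p) (\<delta> w (p d))" .
      qed
    next
      case (local x)
      then obtain u where u: "u \<in> V" "p x \<in> U u"
        using cover pS by blast
      obtain e where e: "e > 0" "\<And>t. t \<in> {0..1} \<Longrightarrow> dist t x < e \<Longrightarrow> p t \<in> U u"
      proof -
        have "\<forall>\<^sub>F t in at x within {0..1}. p t \<in> U u"
          using p(1) local u U[of u] unfolding path_def continuous_on_def
          by (auto intro!: topological_tendstoD[of p "p x"])
        then show ?thesis
          using that u unfolding eventually_at by (metis dist_self)
      qed
      \<comment> \<open>The whole piece lies in the star of \<open>u\<close>: switch from
        \<open>v\<close> to \<open>u\<close> at its start, move inside that star, and switch to
        \<open>w\<close> at its end.\<close>
      have "P a b" if ab: "a \<le> x" "x \<le> b" "b - a < e" for a b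
        unfolding P_def
      proof (intro impI ballI)
        fix v w assume *: "0 \<le> a" "a \<le> b" "b \<le> 1" and vw: "v \<in> V" "w \<in> V" "p a \<in> U v" "p b \<in> U w"
        have in_u: "p t \<in> U u" if "a \<le> t" "t \<le> b" for t
          using that ab * by (intro e(2)) (auto simp: dist_real_def)
        have "homotopic_paths S (\<delta> v (p a) +++ subpath a b p) (\<delta> u (p a) +++ subpath a b p)"
          using * vw u in_u[of a] pS[of a] sub \<delta>[of v "p a"]
          by (intro homotopic_paths_join change) auto
        also have "homotopic_paths S \<dots> (\<delta> u (p b))"
          using within[of u "subpath a b p"] u(1) sub[of a b] * in_u
          by (fastforce simp: path_image_subpath image_subset_iff)
        also have "homotopic_paths S \<dots> (\<delta> w (p b))"
          using * vw u in_u[of b] pS[of b] by (intro change) auto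
        finally show "homotopic_paths S (\<delta> v (p a) +++ subpath a b p) (\<delta> w (p b))" .
      qed
      with e(1) show ?case by blast
    qed
    moreover obtain v where v: "v \<in> V" "p 0 \<in> U v"
      using pS[of 0] cover by auto
    moreover have p01: "p 1 = p 0"
      using p(3) by (simp add: pathstart_def pathfinish_def)
    \<comment> \<open>Since \<open>p 1 = p 0\<close>, the same star \<open>v\<close> may be used at
      both ends of \<open>P 0 1\<close>.\<close>
    ultimately have "homotopic_paths S (\<delta> v (p 0) +++ p) (\<delta> v (p 0))"
      by (auto simp: P_def)
    then show ?thesis
      using p v \<delta>[of v "p 0"] pS[of 0]
      by (intro homotopic_paths_cancel_left[where p = "\<delta> v (p 0)"]) (auto simp: pathstart_def)
  qed
  have "path_connected S"
    unfolding path_connected_def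
  proof (intro ballI)
    fix x y assume xy: "x \<in> S" "y \<in> S"
    then obtain v w where vw: "v \<in> V" "x \<in> U v" "w \<in> V" "y \<in> U w"
      using cover by blast
    show "\<exists>g. path g \<and> path_image g \<subseteq> S \<and> pathstart g = x \<and> pathfinish g = y"
      using \<delta>[of v x] \<delta>[of w y] xy vw
      by (intro exI[of _ "reversepath (\<delta> v x) +++ \<delta> w y"]) (auto simp: path_image_join)
  qed
  with loop show ?thesis
    by (simp add: simply_connected_eq_contractible_path)
qed

section \<open>Paths to the vertices, built along the vertex order\<close>

text \<open>
  Vertices are added in the order given by the rank. The lower part of the link of each new
  vertex is connected, as every vertex of it is joined there to the hub \<open>h\<close> by a path of length
  at most two, so it is irrelevant through which lower neighbour the new vertex is reached.
\<close>

lemma edge_path_system: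
  fixes e :: "'a \<Rightarrow> 'e::real_normed_vector" and r :: "'a \<Rightarrow> nat"
  assumes V: "finite V" and hull: "\<And>\<sigma>. \<sigma> \<in> K \<Longrightarrow> convex hull (e ` \<sigma>) \<subseteq> S"
    and down: "\<And>\<sigma> \<tau>. \<sigma> \<in> K \<Longrightarrow> \<tau> \<subseteq> \<sigma> \<Longrightarrow> \<tau> \<in> K"
    and vert: "\<And>v. v \<in> V \<Longrightarrow> {v} \<in> K"
    and r: "inj_on r V" and v0: "v0 \<in> V" "\<And>v. v \<in> V \<Longrightarrow> r v0 \<le> r v"
    and link: "\<And>u. u \<in> V \<Longrightarrow> u \<noteq> v0 \<Longrightarrow> \<exists>h\<in>V. r h < r u \<and> {u, h} \<in> K \<and>
      (\<forall>a\<in>V. r a < r u \<longrightarrow> {u, a} \<in> K \<longrightarrow> (\<exists>b\<in>V. r b < r u \<and> {u, a, b} \<in> K \<and> {u, b, h} \<in> K))"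
  shows "\<exists>\<gamma>. (\<forall>v\<in>V. path (\<gamma> v) \<and> path_image (\<gamma> v) \<subseteq> S \<and> pathstart (\<gamma> v) = e v0 \<and> pathfinish (\<gamma> v) = e v) \<and>
          (\<forall>v\<in>V. \<forall>w\<in>V. {v, w} \<in> K \<longrightarrow> homotopic_paths S (\<gamma> v +++ linepath (e v) (e w)) (\<gamma> w))"
proof -
  define good where "good W \<gamma> \<longleftrightarrow>
      (\<forall>v\<in>W. path (\<gamma> v) \<and> path_image (\<gamma> v) \<subseteq> S \<and> pathstart (\<gamma> v) = e v0 \<and> pathfinish (\<gamma> v) = e v) \<and>
      (\<forall>v\<in>W. \<forall>w\<in>W. {v, w} \<in> K \<longrightarrow> homotopic_paths S (\<gamma> v +++ linepath (e v) (e w)) (\<gamma> w))" for W \<gamma>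
  have vS: "e v \<in> S" if "v \<in> V" for v
    using hull[OF vert[OF that]] by simp
  have tri: "convex hull {e a, e b, e u} \<subseteq> S" if "{u, a, b} \<in> K" for a b u
    using hull[OF that] by (simp add: insert_commute)
  \<comment> \<open>Settles the degenerate edge \<open>{v, v}\<close>, which the edge condition
    includes.\<close>
  have pt: "homotopic_paths S (p +++ linepath x x) p"
    if "path p" "path_image p \<subseteq> S" "pathfinish p = x" for p x
    using homotopic_paths_rid that by metis
  \<comment> \<open>The values of \<open>r\<close> may have gaps, and \<open>r\<close> is injective,
    so passing from \<open>n\<close> to \<open>Suc n\<close> adds at most one vertex.\<close>
  have "\<exists>\<gamma>. good {v\<in>V. r v < n} \<gamma>" for n
  proof (induction n)
    case (Suc n)
    then obtain \<gamma> where \<gamma>: "good {v\<in>V. r v < n} \<gamma>" by blast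
    show ?case
    proof (cases "\<exists>u\<in>V. r u = n")
      case False
      then have "{v\<in>V. r v < Suc n} = {v\<in>V. r v < n}"
        by (auto simp: less_Suc_eq)
      with \<gamma> show ?thesis by auto
    next
      case True
      then obtain u where u: "u \<in> V" "r u = n" by blast
      then have W: "{v\<in>V. r v < Suc n} = insert u {v\<in>V. r v < n}"
        using inj_onD[OF r] by (auto simp: less_Suc_eq)
      show ?thesis
      proof (cases "u = v0")
        case True
        \<comment> \<open>\<open>v0\<close> has the least rank, so it is the first vertex added, and
          the constant path serves for it.\<close>
        have "{v\<in>V. r v < n} = {}"
          using v0(2) u True by force
        then have "good {v\<in>V. r v < Suc n} (\<lambda>v. linepath (e v) (e v))"
          using vS[OF u(1)] True pt unfolding W by (auto simp: good_def)
        then show ?thesis by blast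
      next
        case False
        then obtain h where h: "h \<in> V" "r h < n" "{u, h} \<in> K"
          and to_h: "\<And>a. a \<in> V \<Longrightarrow> r a < n \<Longrightarrow> {u, a} \<in> K \<Longrightarrow>
             \<exists>b\<in>V. r b < n \<and> {u, a, b} \<in> K \<and> {u, b, h} \<in> K"
          using link[OF u(1)] u(2) by blast
        \<comment> \<open>The new vertex is reached through the hub; \<open>new\<close> then shows
          that every other lower neighbour gives the same class, by sliding from \<open>a\<close>
          over \<open>b\<close> to \<open>h\<close>.\<close>
        define \<delta> where "\<delta> = \<gamma>(u := \<gamma> h +++ linepath (e h) (e u))"
        have old: "path (\<gamma> v)" "path_image (\<gamma> v) \<subseteq> S" "pathstart (\<gamma> v) = e v0" "pathfinish (\<gamma> v) = e v"
          if "v \<in> V" "r v < n" for v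
          using \<gamma> that by (auto simp: good_def)
        have edge: "homotopic_paths S (\<gamma> v +++ linepath (e v) (e w)) (\<gamma> w)"
          if "v \<in> V" "r v < n" "w \<in> V" "r w < n" "{v, w} \<in> K" for v w
          using \<gamma> that by (auto simp: good_def)
        have same: "\<delta> v = \<gamma> v" if "r v < n" for v
          using that u by (auto simp: \<delta>_def)
        have slide: "homotopic_paths S (\<gamma> a +++ linepath (e a) (e u)) (\<gamma> b +++ linepath (e b) (e u))"
          if "a \<in> V" "r a < n" "b \<in> V" "r b < n" "{u, a, b} \<in> K" for a b
          using that old[of a] edge[of a b] tri[of u a b] down[of "{u, a, b}" "{a, b}"]
          by (intro homotopic_paths_slide) auto
        have new: "homotopic_paths S (\<gamma> a +++ linepath (e a) (e u)) (\<delta> u)"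
          if a: "a \<in> V" "r a < n" "{u, a} \<in> K" for a
        proof -
          obtain b where b: "b \<in> V" "r b < n" "{u, a, b} \<in> K" "{u, b, h} \<in> K"
            using to_h a by blast
          have "homotopic_paths S (\<gamma> a +++ linepath (e a) (e u)) (\<gamma> h +++ linepath (e h) (e u))"
            using slide[of a b] slide[of b h] a b h by (blast intro: homotopic_paths_trans)
          then show ?thesis
            by (simp add: \<delta>_def)
        qed
        have \<delta>u: "path (\<delta> u)" "path_image (\<delta> u) \<subseteq> S" "pathstart (\<delta> u) = e v0" "pathfinish (\<delta> u) = e u"
          using new[OF h] old[OF h(1,2)]
          by (auto simp: \<delta>_def dest: homotopic_paths_imp_path homotopic_paths_imp_subset)
        have flip: "homotopic_paths S (\<delta> u +++ linepath (e u) (e a)) (\<gamma> a)"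
          if a: "a \<in> V" "r a < n" "{u, a} \<in> K" for a
        proof -
          \<comment> \<open>The reversed edge comes from sliding over the degenerate triangle
            \<open>a\<close>, \<open>u\<close>, \<open>a\<close>.\<close>
          have "homotopic_paths S (\<gamma> a +++ linepath (e a) (e a)) (\<delta> u +++ linepath (e u) (e a))"
            using old[of a] new[of a] tri[of a a u] a
            by (intro homotopic_paths_slide) (auto simp: insert_commute)
          then show ?thesis
            using pt[of "\<gamma> a"] old[of a] a by (metis homotopic_paths_sym homotopic_paths_trans)
        qed
        have "good {v\<in>V. r v < Suc n} \<delta>"
          unfolding W good_def using old edge same new flip \<delta>u pt[OF \<delta>u(1,2,4)] \<delta>u
          by (auto simp: insert_commute)
        then show ?thesis by blast
      qed
    qed
  qed (simp add: good_def)
  then obtain \<gamma> where "good {v\<in>V. r v < Suc (Max (r ` V))} \<gamma>" by blast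
  moreover have "{v\<in>V. r v < Suc (Max (r ` V))} = V"
    using V by (auto simp: less_Suc_eq_le)
  ultimately show ?thesis
    unfolding good_def by (intro exI[of _ \<gamma>]) simp
qed

section \<open>Transfer of the realization to a normed space\<close>

text \<open>
  The function type carrying the realization is not a normed space. The space of bounded sequences
  only serves as a normed space that contains independent families of every finite size.
\<close>

lemma finite_dual_family:
  assumes "finite V"
  obtains e :: "'a \<Rightarrow> nat \<Rightarrow>\<^sub>C real" and c :: "'a \<Rightarrow> (nat \<Rightarrow>\<^sub>C real) \<Rightarrow> real"
  where "\<And>v. bounded_linear (c v)"
    and "\<And>v w. v \<in> V \<Longrightarrow> w \<in> V \<Longrightarrow> c v (e w) = of_bool (v = w)"
proof -
  obtain f :: "'a \<Rightarrow> nat" where f: "inj_on f V"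
    using finite_imp_inj_to_nat_seg[OF assms] by blast
  \<comment> \<open>Unit sequences: evaluation at \<open>f v\<close> is the functional dual to
    \<open>e v\<close>.\<close>
  define e where "e v = Bcontfun (\<lambda>n. of_bool (n = f v) :: real)" for v
  have "(\<lambda>n. of_bool (n = f v) :: real) \<in> bcontfun" for v
    by (auto simp: bcontfun_def bounded_iff intro!: exI[of _ 1])
  then have e: "apply_bcontfun (e v) n = of_bool (n = f v)" for v n
    by (simp add: e_def Bcontfun_inverse)
  have "bounded_linear (\<lambda>y. apply_bcontfun y (f v))" for v
    using norm_bounded by (intro bounded_linear_intro[where K = 1]) auto
  moreover have "apply_bcontfun (e w) (f v) = of_bool (v = w)" if "v \<in> V" "w \<in> V" for v w
    using inj_onD[OF f] that by (auto simp: e)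
  ultimately show thesis
    by (rule that)
qed

text \<open>Loops in \<open>T\<close> are lifted by \<open>k\<close>, joined by a free homotopy in
  \<open>S\<close>, and brought back by \<open>h\<close>, which returns the original loops.\<close>

lemma simply_connected_retract:
  assumes S: "simply_connected S" and h: "continuous_on S h" "h \<in> S \<rightarrow> T"
    and k: "continuous_on T k" "k \<in> T \<rightarrow> S" and hk: "\<And>x. x \<in> T \<Longrightarrow> h (k x) = x"
  shows "simply_connected T"
  unfolding simply_connected_def
proof (intro allI impI)
  fix p q :: "real \<Rightarrow> 'b"
  assume pq: "path p \<and> pathfinish p = pathstart p \<and> path_image p \<subseteq> T \<and>
              path q \<and> pathfinish q = pathstart q \<and> path_image q \<subseteq> T"
  have lift: "path (k \<circ> r)" "path_image (k \<circ> r) \<subseteq> S" if "path r" "path_image r \<subseteq> T" for r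
    by (rule path_continuous_image[OF that(1) continuous_on_subset[OF k(1) that(2)]])
      (use that(2) k(2) in \<open>auto simp: path_image_def\<close>)
  have "homotopic_loops S (k \<circ> p) (k \<circ> q)"
    using S lift[of p] lift[of q] pq by (simp add: simply_connected_def pathfinish_compose pathstart_compose)
  then have "homotopic_loops T (h \<circ> (k \<circ> p)) (h \<circ> (k \<circ> q))"
    using h by (rule homotopic_loops_continuous_image)
  moreover have "homotopic_loops T r (h \<circ> (k \<circ> r))"
    if "path r" "pathfinish r = pathstart r" "path_image r \<subseteq> T" for r
    using that hk by (intro homotopic_loops_eq) (auto simp: path_image_def image_subset_iff)
  ultimately show "homotopic_loops T p q"
    using pq by (meson homotopic_loops_sym homotopic_loops_trans)
qed

text \<open>The linear map \<open>\<phi>\<close> copies the realization into a normed space, where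
  segments and hulls are available. The functionals \<open>c v\<close> read off the barycentric
  coordinates, so \<open>c v y > 0\<close> describes the open star of \<open>v\<close>. The vertex
  order supplies the paths for the star cover, and the result is carried back by
  \<open>coord\<close>.\<close>

lemma simply_connected_complex_vertex_order:
  fixes K :: "'a set set" and r :: "'a \<Rightarrow> nat"
  assumes V: "finite V" "\<Union>K \<subseteq> V"
    and down: "\<And>\<sigma> \<tau>. \<sigma> \<in> K \<Longrightarrow> \<tau> \<subseteq> \<sigma> \<Longrightarrow> \<tau> \<in> K"
    and vert: "\<And>v. v \<in> V \<Longrightarrow> {v} \<in> K"
    and r: "inj_on r V" and v0: "v0 \<in> V" "\<And>v. v \<in> V \<Longrightarrow> r v0 \<le> r v"
    and link: "\<And>u. u \<in> V \<Longrightarrow> u \<noteq> v0 \<Longrightarrow> \<exists>h\<in>V. r h < r u \<and> {u, h} \<in> K \<and>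
      (\<forall>a\<in>V. r a < r u \<longrightarrow> {u, a} \<in> K \<longrightarrow> (\<exists>b\<in>V. r b < r u \<and> {u, a, b} \<in> K \<and> {u, b, h} \<in> K))"
  shows "simply_connected_complex K"
proof -
  obtain c :: "'a \<Rightarrow> (nat \<Rightarrow>\<^sub>C real) \<Rightarrow> real" and e where c: "\<And>v. bounded_linear (c v)"
    and ce: "\<And>v w. v \<in> V \<Longrightarrow> w \<in> V \<Longrightarrow> c v (e w) = of_bool (v = w)"
    using finite_dual_family[OF V(1)] by metis
  define \<phi> where "\<phi> x = (\<Sum>v\<in>V. x v *\<^sub>R e v)" for x :: "'a \<Rightarrow> real"
  define S where "S = \<phi> ` geometric_realization K"
  have supp: "{v. x v \<noteq> 0} \<subseteq> V" if "x \<in> geometric_realization K" for x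
    using that V by (auto simp: geometric_realization_def)
  have c\<phi>: "c v (\<phi> x) = x v" if "v \<in> V" for v x
  proof -
    have "c v (\<phi> x) = (\<Sum>w\<in>V. x w * of_bool (v = w))"
      using c[of v] ce that by (simp add: \<phi>_def linear_sum linear_scale bounded_linear.linear)
    then show ?thesis
      using that V by simp
  qed
  have inj: "inj_on e V"
  proof (rule inj_onI)
    fix v w assume "v \<in> V" "w \<in> V" "e v = e w"
    then show "v = w"
      using ce[of v v] ce[of v w] by (auto split: if_splits)
  qed
  have hull: "convex hull (e ` \<sigma>) \<subseteq> S" if \<sigma>: "\<sigma> \<in> K" for \<sigma>
  proof
    fix y assume y: "y \<in> convex hull (e ` \<sigma>)"
    have fin: "finite \<sigma>" "\<sigma> \<subseteq> V"
      using V \<sigma> by (auto intro: finite_subset)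
    obtain u where u: "\<And>z. z \<in> e ` \<sigma> \<Longrightarrow> 0 \<le> u z" "sum u (e ` \<sigma>) = 1" "(\<Sum>z\<in>e ` \<sigma>. u z *\<^sub>R z) = y"
      using y fin by (auto simp: convex_hull_finite)
    \<comment> \<open>Barycentric coordinates of \<open>y\<close>, extended by zero. Their support
      may be a proper face of \<open>\<sigma>\<close>, hence the appeal to
      \<open>down\<close>.\<close>
    define x where "x v = (if v \<in> \<sigma> then u (e v) else 0)" for v
    have inj\<sigma>: "inj_on e \<sigma>"
      using inj fin inj_on_subset by blast
    have "(\<Sum>v | x v \<noteq> 0. x v) = (\<Sum>v\<in>\<sigma>. x v)"
      using fin by (intro sum.mono_neutral_left) (auto simp: x_def)
    also have "\<dots> = 1"
      using u(2) inj\<sigma> by (simp add: sum.reindex x_def)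
    finally have sum1: "(\<Sum>v | x v \<noteq> 0. x v) = 1" .
    have "{v. x v \<noteq> 0} \<in> K" "\<And>v. 0 \<le> x v"
      using u(1) by (auto intro!: down[OF \<sigma>] simp: x_def split: if_splits)
    with sum1 have "x \<in> geometric_realization K"
      by (simp add: geometric_realization_def)
    moreover have "\<phi> x = (\<Sum>v\<in>\<sigma>. x v *\<^sub>R e v)"
      unfolding \<phi>_def using fin V by (intro sum.mono_neutral_right) (auto simp: x_def)
    then have "\<phi> x = y"
      using u(3) inj\<sigma> by (simp add: sum.reindex x_def)
    ultimately show "y \<in> S"
      by (auto simp: S_def)
  qed
  have simplex: "\<phi> x \<in> convex hull (e ` {v. x v \<noteq> 0})" if x: "x \<in> geometric_realization K" for x
  proof -
    let ?\<sigma> = "{v. x v \<noteq> 0}"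
    have "\<phi> x = (\<Sum>v\<in>?\<sigma>. x v *\<^sub>R e v)"
      unfolding \<phi>_def using supp[OF x] V by (intro sum.mono_neutral_right) auto
    also have "\<dots> \<in> convex hull (e ` ?\<sigma>)"
      using x supp[OF x] V(1) finite_subset
      by (intro convex_sum) (auto simp: geometric_realization_def hull_inc)
    finally show ?thesis .
  qed
  \<comment> \<open>The support of a point is itself a simplex and contains every vertex with
    positive coordinate. Hence a point of two stars lies in a simplex having both centres as
    vertices, which gives the triangles and edges that the star cover requires.\<close>
  have common: "\<exists>\<sigma>\<in>K. v \<in> \<sigma> \<and> w \<in> \<sigma> \<and> y \<in> convex hull (e ` \<sigma>)"
    if "v \<in> V" "w \<in> V" "y \<in> S" "c v y > 0" "c w y > 0" for v w y
  proof -
    obtain x where x: "x \<in> geometric_realization K" "y = \<phi> x"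
      using \<open>y \<in> S\<close> by (auto simp: S_def)
    then show ?thesis
      using that simplex[of x] c\<phi> by (intro bexI[of _ "{v. x v \<noteq> 0}"]) (auto simp: geometric_realization_def)
  qed
  have "\<exists>\<gamma>. (\<forall>v\<in>V. path (\<gamma> v) \<and> path_image (\<gamma> v) \<subseteq> S \<and> pathstart (\<gamma> v) = e v0 \<and> pathfinish (\<gamma> v) = e v) \<and>
      (\<forall>v\<in>V. \<forall>w\<in>V. {v, w} \<in> K \<longrightarrow> homotopic_paths S (\<gamma> v +++ linepath (e v) (e w)) (\<gamma> w))"
    using V(1) hull down vert r v0 link by (rule edge_path_system)
  then obtain \<gamma> where \<gamma>: "\<And>v. v\<in>V \<Longrightarrow> path (\<gamma> v)" "\<And>v. v\<in>V \<Longrightarrow> path_image (\<gamma> v) \<subseteq> S"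
      "\<And>v. v\<in>V \<Longrightarrow> pathstart (\<gamma> v) = e v0" "\<And>v. v\<in>V \<Longrightarrow> pathfinish (\<gamma> v) = e v"
    and edge: "\<And>v w. v\<in>V \<Longrightarrow> w\<in>V \<Longrightarrow> {v, w} \<in> K \<Longrightarrow> homotopic_paths S (\<gamma> v +++ linepath (e v) (e w)) (\<gamma> w)"
    by blast
  have "simply_connected S"
  proof (rule simply_connected_star_cover[where U = "\<lambda>v. {y. c v y > 0}" and V = V, OF _ _ _ \<gamma>])
    show "open {y. c v y > 0}" for v
      using linear_continuous_on[OF c] by (intro open_Collect_less continuous_intros)
    show "S \<subseteq> (\<Union>v\<in>V. {y. c v y > 0})"
    proof
      fix y assume "y \<in> S"
      then obtain x where x: "x \<in> geometric_realization K" "y = \<phi> x"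
        by (auto simp: S_def)
      have "\<exists>v. x v \<noteq> 0"
      proof (rule ccontr)
        assume "\<nexists>v. x v \<noteq> 0"
        then show False
          using x(1) by (simp add: geometric_realization_def)
      qed
      then obtain v where "x v > 0"
        using x by (auto simp: geometric_realization_def order.strict_iff_order)
      moreover from this have "v \<in> V"
        using supp[OF x(1)] by auto
      ultimately show "y \<in> (\<Union>v\<in>V. {y. c v y > 0})"
        using x(2) c\<phi> by auto
    qed
    show "convex hull {e v, e w, y} \<subseteq> S"
      if "v \<in> V" "w \<in> V" "y \<in> S" "y \<in> {y. c v y > 0}" "y \<in> {y. c w y > 0}" for v w y
    proof -
      obtain \<sigma> where \<sigma>: "\<sigma> \<in> K" "v \<in> \<sigma>" "w \<in> \<sigma>" "y \<in> convex hull (e ` \<sigma>)"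
        using common[OF \<open>v \<in> V\<close> \<open>w \<in> V\<close> \<open>y \<in> S\<close>] \<open>y \<in> {y. c v y > 0}\<close> \<open>y \<in> {y. c w y > 0}\<close>
        by auto
      then have "{e v, e w, y} \<subseteq> convex hull (e ` \<sigma>)"
        by (auto intro: hull_inc)
      then show ?thesis
        using hull[OF \<sigma>(1)] by (meson convex_convex_hull hull_minimal subset_trans)
    qed
    show "homotopic_paths S (\<gamma> v +++ linepath (e v) (e w)) (\<gamma> w)"
      if vw: "v \<in> V" "w \<in> V" "S \<inter> {y. c v y > 0} \<inter> {y. c w y > 0} \<noteq> {}" for v w
    proof (rule edge)
      obtain y where "y \<in> S" "c v y > 0" "c w y > 0"
        using vw(3) by auto
      then obtain \<sigma> where "\<sigma> \<in> K" "{v, w} \<subseteq> \<sigma>"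
        using common[OF vw(1,2)] by auto
      then show "{v, w} \<in> K"
        by (rule down)
    qed (use vw in auto)
  qed
  \<comment> \<open>The duality of \<open>c\<close> and \<open>e\<close> is known on
    \<open>V\<close> only; setting the other coordinates to zero agrees with the realization, whose
    points vanish outside \<open>V\<close>.\<close>
  define coord where "coord y v = (if v \<in> V then c v y else 0)" for y v
  have coord_\<phi>: "coord (\<phi> x) = x" if "x \<in> geometric_realization K" for x
    using supp[OF that] by (auto simp: coord_def c\<phi> fun_eq_iff)
  have "simply_connected (geometric_realization K)"
  proof (rule simply_connected_retract[of S coord _ \<phi>, OF \<open>simply_connected S\<close> _ _ _ _ coord_\<phi>])
    show "continuous_on S coord"
    proof (rule continuous_on_coordinatewise_then_product)
      show "continuous_on S (\<lambda>y. coord y v)" for v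
        by (cases "v \<in> V") (simp_all add: coord_def linear_continuous_on c)
    qed
    show "continuous_on (geometric_realization K) \<phi>"
      unfolding \<phi>_def
      by (intro continuous_on_sum continuous_on_scaleR continuous_on_const
          continuous_on_subset[OF continuous_on_product_coordinates subset_UNIV])
  qed (auto simp: S_def coord_\<phi>)
  moreover have "(\<lambda>v. of_bool (v = v0)) \<in> geometric_realization K"
    using vert[OF v0(1)] by (simp add: geometric_realization_def)
  ultimately show ?thesis
    by (auto simp: simply_connected_complex_def)
qed

section \<open>Row by row order on a board\<close>

text \<open>Turns the lexicographic order of squares into a natural number rank, so that for a
  concrete piece only the link condition is left, stated by comparing rows and columns.\<close>

lemma simply_connected_neighbourhood_complex_grid:
  fixes p q :: nat
  assumes G: "pair_graph G" "pverts G = {1..p} \<times> {1..q}" and pq: "p \<ge> 1" "q \<ge> 1"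
    and nbr: "\<And>v. v \<in> pverts G \<Longrightarrow> \<exists>w. (v, w) \<in> parcs G"
    and link: "\<And>i j. (i, j) \<in> pverts G \<Longrightarrow> (i, j) \<noteq> (1, 1) \<Longrightarrow>
      \<exists>h\<in>pverts G. (fst h < i \<or> fst h = i \<and> snd h < j) \<and> {(i, j), h} \<in> neighbourhood_complex G \<and>
      (\<forall>a\<in>pverts G. fst a < i \<or> fst a = i \<and> snd a < j \<longrightarrow> {(i, j), a} \<in> neighbourhood_complex G \<longrightarrow>
         (\<exists>b\<in>pverts G. (fst b < i \<or> fst b = i \<and> snd b < j) \<and>
            {(i, j), a, b} \<in> neighbourhood_complex G \<and> {(i, j), b, h} \<in> neighbourhood_complex G))"
  shows "simply_connected_complex (neighbourhood_complex G)"
proof -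
  \<comment> \<open>The factor \<open>Suc q\<close> exceeds every column index, so a smaller row
    always means a smaller rank.\<close>
  define r where "r v = fst v * Suc q + snd v" for v :: "nat \<times> nat"
  have less: "r v < r w \<longleftrightarrow> fst v < fst w \<or> fst v = fst w \<and> snd v < snd w"
    if "v \<in> pverts G" "w \<in> pverts G" for v w
  proof -
    have *: "r x < r y" if "fst x < fst y" "snd x \<le> q" for x y
    proof -
      have "r x < Suc (fst x) * Suc q"
        using that(2) by (simp add: r_def)
      also have "\<dots> \<le> fst y * Suc q"
        using that(1) by (intro mult_le_mono1) simp
      finally show ?thesis
        by (simp add: r_def)
    qed
    show ?thesis
      using that G(2) *[of v w] *[of w v] by (cases "fst v" "fst w" rule: linorder_cases) (auto simp: r_def)
  qed
  interpret pair_graph G by (fact G(1))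
  show ?thesis
  proof (rule simply_connected_complex_vertex_order[where V = "pverts G" and r = r and ?v0.0 = "(1, 1)"])
    show "inj_on r (pverts G)"
    proof (rule inj_onI)
      fix v w assume "v \<in> pverts G" "w \<in> pverts G" "r v = r w"
      then show "v = w"
        using less[of v w] less[of w v] by (cases v; cases w) auto
    qed
    show "(1, 1) \<in> pverts G"
      using G pq by simp
    then show "r (1, 1) \<le> r v" if "v \<in> pverts G" for v
      using less[of v "(1, 1)"] that G(2) by (auto simp: not_less[symmetric])
    show "{v} \<in> neighbourhood_complex G" if v: "v \<in> pverts G" for v
    proof -
      obtain w where "(v, w) \<in> parcs G"
        using nbr[OF v] by blast
      then show ?thesis
        using v in_arcsD2[of v w] by (auto simp: neighbourhood_complex_def)
    qed
    show "\<exists>h\<in>pverts G. r h < r u \<and> {u, h} \<in> neighbourhood_complex G \<and>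
        (\<forall>a\<in>pverts G. r a < r u \<longrightarrow> {u, a} \<in> neighbourhood_complex G \<longrightarrow>
          (\<exists>b\<in>pverts G. r b < r u \<and> {u, a, b} \<in> neighbourhood_complex G \<and> {u, b, h} \<in> neighbourhood_complex G))"
      if u: "u \<in> pverts G" "u \<noteq> (1, 1)" for u
    proof -
      obtain i j where [simp]: "u = (i, j)" by (cases u)
      show ?thesis
        using link[of i j] u less[of _ u] by simp
    qed
  next
    show "finite (pverts G)" "\<Union>(neighbourhood_complex G) \<subseteq> pverts G"
      using G(2) by (auto simp: neighbourhood_complex_def)
    show "\<tau> \<in> neighbourhood_complex G" if "\<sigma> \<in> neighbourhood_complex G" "\<tau> \<subseteq> \<sigma>" for \<sigma> \<tau>
      using that by (rule neighbourhood_complex_mono)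
  qed
qed

section \<open>The queen graph\<close>

lemma queen_arc_iff:
  "((i, j), (k, l)) \<in> parcs (queen_graph p q) \<longleftrightarrow>
    1 \<le> i \<and> i \<le> p \<and> 1 \<le> j \<and> j \<le> q \<and> 1 \<le> k \<and> k \<le> p \<and> 1 \<le> l \<and> l \<le> q \<and> (i \<noteq> k \<or> j \<noteq> l) \<and>
    (i = k \<or> j = l \<or> i + j = k + l \<or> i + l = k + j)"
proof -
  have "\<bar>int i - int k\<bar> = \<bar>int j - int l\<bar> \<longleftrightarrow> i + j = k + l \<or> i + l = k + j"
    by linarith
  then show ?thesis
    by (auto simp: queen_graph_def)
qed

text \<open>The hub \<open>h\<close> is next to \<open>(i, j)\<close>, so the two squares share many
  lines, and one of these can be met by a queen from any earlier square. Thus the lower link is a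
  cone with apex \<open>h\<close>. The cases avoid a witness that coincides with one of the three
  squares.\<close>

lemma queen_common_neighbour:
  assumes pq: "2 \<le> p" "2 \<le> q" and ij: "1 \<le> i" "i \<le> p" "1 \<le> j" "j \<le> q"
    and xy: "1 \<le> x" "x \<le> p" "1 \<le> y" "y \<le> q" and lower: "x < i \<or> x = i \<and> y < j"
    and h: "h = (if i = 1 then (1, j - 1) else (i - 1, j))"
  obtains w where "((i, j), w) \<in> parcs (queen_graph p q)" "((x, y), w) \<in> parcs (queen_graph p q)"
    "(h, w) \<in> parcs (queen_graph p q)"
proof -
  \<comment> \<open>A column next to \<open>j\<close>, which exists because there are at least two
    columns.\<close>
  define j' where "j' = (if j = 1 then 2 else j - 1)"
  have j': "1 \<le> j'" "j' \<le> q" "j' = j + 1 \<or> j = j' + 1"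
    using pq ij by (auto simp: j'_def)
  show thesis
  proof (cases "i = 1")
    case i: True
    \<comment> \<open>In the first row, \<open>(1, j - 2)\<close> sees all three squares along the
      row unless it is, or lies to the left of, \<open>(x, y)\<close>; then row 2 supplies the
      witness.\<close>
    consider "y + 1 = j" | "y + 2 = j" | "y + 2 < j"
      using lower xy i by linarith
    then show thesis
    proof cases
      case 1
      with i show thesis
        using pq ij xy lower h by (intro that[of "(2, j)"]) (auto simp: queen_arc_iff)
    next
      case 2
      with i show thesis
        using pq ij xy lower h by (intro that[of "(2, j - 1)"]) (auto simp: queen_arc_iff)
    next
      case 3
      with i show thesis
        using pq ij xy lower h by (intro that[of "(1, j - 2)"]) (auto simp: queen_arc_iff)
    qed
  next
    case i: False
    show thesis
    proof (cases "x = i")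
      case x: True
      consider "y + 1 = j" | "y + 1 < j"
        using lower xy i x by linarith
      then show thesis
      proof cases
        case 1
        with i x show thesis
          using pq ij xy lower h by (intro that[of "(i - 1, j - 1)"]) (auto simp: queen_arc_iff)
      next
        case 2
        with i x show thesis
          using pq ij xy lower h by (intro that[of "(i, j - 1)"]) (auto simp: queen_arc_iff)
      qed
    next
      case x: False
      show thesis
      proof (cases "y = j")
        case y: True
        \<comment> \<open>In column \<open>j\<close>, the square \<open>(i - 2, j)\<close> serves
          from below \<open>(x, y)\<close> when there is room; otherwise step aside to column
          \<open>j'\<close>.\<close>
        consider "x + 1 = i" | "x + 2 = i" | "x + 2 < i"
          using lower xy i x y by linarith
        then show thesis
        proof cases
          case 1
          with i x y show thesis
            using pq ij xy lower h j' by (intro that[of "(i, j')"]) (auto simp: queen_arc_iff)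
        next
          case 2
          with i x y show thesis
            using pq ij xy lower h j' by (intro that[of "(i - 1, j')"]) (auto simp: queen_arc_iff)
        next
          case 3
          with i x y show thesis
            using pq ij xy lower h by (intro that[of "(i - 2, j)"]) (auto simp: queen_arc_iff)
        qed
      next
        case y: False
        \<comment> \<open>Above row \<open>i - 1\<close>, row \<open>x\<close> meets column
          \<open>j\<close> in a square different from \<open>h\<close>. In row \<open>i - 1\<close>
          the witness is the square below \<open>(x, y)\<close> if \<open>(x, y)\<close> is beside
          \<open>h\<close>, and otherwise the square beside \<open>h\<close> on the side of
          \<open>(x, y)\<close>.\<close>
        consider "x + 1 < i" | "x + 1 = i \<and> (y = j + 1 \<or> j = y + 1)" | "x + 1 = i \<and> y > j + 1" | "x + 1 = i \<and> j > y + 1"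
          using lower xy i x y by linarith
        then show thesis
        proof cases
          case 1
          with i x y show thesis
            using pq ij xy lower h by (intro that[of "(x, j)"]) (auto simp: queen_arc_iff)
        next
          case 2
          with i x y show thesis
            using pq ij xy lower h by (intro that[of "(i, y)"]) (auto simp: queen_arc_iff)
        next
          case 3
          with i x y show thesis
            using pq ij xy lower h by (intro that[of "(i - 1, j + 1)"]) (auto simp: queen_arc_iff)
        next
          case 4
          with i x y show thesis
            using pq ij xy lower h by (intro that[of "(i - 1, j - 1)"]) (auto simp: queen_arc_iff)
        qed
      qed
    qed
  qed
qed

text \<open>Arcs join vertices only, so with at least one arc into \<open>w\<close> the membership
  conditions on vertices follow.\<close>

lemma in_neighbourhood_complex_iff:
  assumes "pair_graph G" "finite \<sigma>" "\<sigma> \<noteq> {}"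
  shows "\<sigma> \<in> neighbourhood_complex G \<longleftrightarrow> (\<exists>w. \<forall>v\<in>\<sigma>. (v, w) \<in> parcs G)"
proof -
  interpret pair_graph G by fact
  show ?thesis
  proof
    assume "\<exists>w. \<forall>v\<in>\<sigma>. (v, w) \<in> parcs G"
    then obtain w where w: "\<And>v. v \<in> \<sigma> \<Longrightarrow> (v, w) \<in> parcs G"
      by blast
    moreover obtain v where "v \<in> \<sigma>"
      using assms(3) by blast
    ultimately have "w \<in> pverts G"
      using in_arcsD2 by blast
    moreover have "\<sigma> \<subseteq> pverts G"
      using w in_arcsD1 by blast
    ultimately show "\<sigma> \<in> neighbourhood_complex G"
      using w assms(2) by (auto simp: neighbourhood_complex_def)
  qed (auto simp: neighbourhood_complex_def)
qed

lemma simply_connected_queen: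
  assumes pq: "2 \<le> p" "2 \<le> q"
  shows "simply_connected_complex (neighbourhood_complex (queen_graph p q))"
proof (rule simply_connected_neighbourhood_complex_grid[OF pair_graph_queen_graph])
  let ?G = "queen_graph p q"
  note iff = in_neighbourhood_complex_iff[OF pair_graph_queen_graph]
  show verts: "pverts ?G = {1..p} \<times> {1..q}"
    by (simp add: queen_graph_def)
  show "\<exists>w. (v, w) \<in> parcs ?G" if "v \<in> pverts ?G" for v
  proof (cases v)
    case (Pair i j)
    then show ?thesis
      using that pq
      by (intro exI[of _ "(i, if j = 1 then 2 else j - 1)"]) (auto simp: verts queen_arc_iff)
  qed
  show "\<exists>h\<in>pverts ?G. (fst h < i \<or> fst h = i \<and> snd h < j) \<and> {(i, j), h} \<in> neighbourhood_complex ?G \<and>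
      (\<forall>a\<in>pverts ?G. fst a < i \<or> fst a = i \<and> snd a < j \<longrightarrow> {(i, j), a} \<in> neighbourhood_complex ?G \<longrightarrow>
         (\<exists>b\<in>pverts ?G. (fst b < i \<or> fst b = i \<and> snd b < j) \<and>
            {(i, j), a, b} \<in> neighbourhood_complex ?G \<and> {(i, j), b, h} \<in> neighbourhood_complex ?G))"
    if ij: "(i, j) \<in> pverts ?G" "(i, j) \<noteq> (1, 1)" for i j
  proof -
    define h where "h = (if i = 1 then (1, j - 1) else (i - 1, j))"
    have h: "h \<in> pverts ?G" "fst h < i \<or> fst h = i \<and> snd h < j"
      using ij by (auto simp: h_def verts)
    have triple: "{(i, j), a, h} \<in> neighbourhood_complex ?G"
      if a: "a \<in> pverts ?G" "fst a < i \<or> fst a = i \<and> snd a < j" for a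
    proof -
      obtain x y where "a = (x, y)" by (cases a)
      obtain w where "((i, j), w) \<in> parcs ?G" "((x, y), w) \<in> parcs ?G" "(h, w) \<in> parcs ?G"
        by (rule queen_common_neighbour[OF pq _ _ _ _ _ _ _ _ _ h_def, of x y])
          (use ij a \<open>a = (x, y)\<close> in \<open>auto simp: verts\<close>)
      then show ?thesis
        using \<open>a = (x, y)\<close> by (intro iff[THEN iffD2] exI[of _ w]) auto
    qed
    show ?thesis
    proof (rule bexI[of _ h], intro conjI ballI impI)
      show "{(i, j), h} \<in> neighbourhood_complex ?G"
        using triple[OF h] by simp
      show "\<exists>b\<in>pverts ?G. (fst b < i \<or> fst b = i \<and> snd b < j) \<and>
            {(i, j), a, b} \<in> neighbourhood_complex ?G \<and> {(i, j), b, h} \<in> neighbourhood_complex ?G"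
        if "a \<in> pverts ?G" "fst a < i \<or> fst a = i \<and> snd a < j" "{(i, j), a} \<in> neighbourhood_complex ?G" for a
        \<comment> \<open>As the link is a cone, \<open>a\<close> itself serves as the intermediate
          vertex \<open>b\<close>.\<close>
        using that triple by (intro bexI[of _ a]) auto
    qed (use h in auto)
  qed
qed (use pq in auto)

section \<open>The king graph\<close>

lemma king_arc_iff:
  "((i, j), (k, l)) \<in> parcs (king_graph p q) \<longleftrightarrow>
    1 \<le> i \<and> i \<le> p \<and> 1 \<le> j \<and> j \<le> q \<and> 1 \<le> k \<and> k \<le> p \<and> 1 \<le> l \<and> l \<le> q \<and> (i \<noteq> k \<or> j \<noteq> l) \<and>
    i \<le> k + 1 \<and> k \<le> i + 1 \<and> j \<le> l + 1 \<and> l \<le> j + 1"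
proof -
  have "\<bar>int i - int k\<bar> \<le> 1 \<longleftrightarrow> i \<le> k + 1 \<and> k \<le> i + 1" for i k
    by linarith
  then show ?thesis
    by (auto simp: king_graph_def)
qed

text \<open>A king moves one step only, so the argument starts from a common neighbour of
  \<open>(i, j)\<close> and the earlier square \<open>a\<close>. Either this neighbour also sees the
  hub, or it is replaced by another one, or the path to the hub takes a detour over a third
  square.\<close>

lemma simply_connected_king:
  assumes pq: "2 \<le> p" "2 \<le> q"
  shows "simply_connected_complex (neighbourhood_complex (king_graph p q))"
proof (rule simply_connected_neighbourhood_complex_grid[OF pair_graph_king_graph])
  let ?G = "king_graph p q"
  note iff = in_neighbourhood_complex_iff[OF pair_graph_king_graph]
  show verts: "pverts ?G = {1..p} \<times> {1..q}"
    by (simp add: king_graph_def)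
  show "\<exists>w. (v, w) \<in> parcs ?G" if "v \<in> pverts ?G" for v
  proof (cases v)
    case (Pair i j)
    then show ?thesis
      using that pq
      by (intro exI[of _ "(i, if j = 1 then 2 else j - 1)"]) (auto simp: verts king_arc_iff)
  qed
  \<comment> \<open>Stated for triples; a repeated entry gives an edge.\<close>
  have mem: "{a, b, c} \<in> neighbourhood_complex ?G"
    if "(a, w) \<in> parcs ?G" "(b, w) \<in> parcs ?G" "(c, w) \<in> parcs ?G" for a b c w
    using that by (intro iff[THEN iffD2] exI[of _ w]) auto
  show "\<exists>h\<in>pverts ?G. (fst h < i \<or> fst h = i \<and> snd h < j) \<and> {(i, j), h} \<in> neighbourhood_complex ?G \<and>
      (\<forall>a\<in>pverts ?G. fst a < i \<or> fst a = i \<and> snd a < j \<longrightarrow> {(i, j), a} \<in> neighbourhood_complex ?G \<longrightarrow>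
         (\<exists>b\<in>pverts ?G. (fst b < i \<or> fst b = i \<and> snd b < j) \<and>
            {(i, j), a, b} \<in> neighbourhood_complex ?G \<and> {(i, j), b, h} \<in> neighbourhood_complex ?G))"
    if ij: "(i, j) \<in> pverts ?G" "(i, j) \<noteq> (1, 1)" for i j
  proof (cases "i = 1")
    case i: True
    have triple: "{(i, j), (x, y), (1, j - 1)} \<in> neighbourhood_complex ?G"
      if xy: "1 \<le> y" "x = 1" "y < j" "{(i, j), (x, y)} \<in> neighbourhood_complex ?G" for x y
    proof -
      obtain k l where "((i, j), (k, l)) \<in> parcs ?G" "((x, y), (k, l)) \<in> parcs ?G"
        using xy by (auto simp: iff)
      \<comment> \<open>Both squares see column \<open>l\<close>, so \<open>y\<close> is
        \<open>j - 1\<close> or \<open>j - 2\<close>, and \<open>(2, j - 1)\<close> lies below or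
        diagonally below all three squares.\<close>
      then have "j \<le> y + 2"
        by (auto simp: king_arc_iff)
      then show ?thesis
        using xy i ij pq by (intro mem[of _ "(2, j - 1)"]) (auto simp: king_arc_iff verts)
    qed
    have h: "(1, j - 1) \<in> pverts ?G"
      using i ij by (auto simp: verts)
    have "{(i, j), (1, j - 1), (1, j - 1)} \<in> neighbourhood_complex ?G"
      using i ij pq by (intro mem[of _ "(2, j)"]) (auto simp: king_arc_iff verts)
    then have edge: "{(i, j), (1, j - 1)} \<in> neighbourhood_complex ?G"
      by simp
    show ?thesis
    proof (rule bexI[of _ "(1, j - 1)"], intro conjI ballI impI)
      show "\<exists>b\<in>pverts ?G. (fst b < i \<or> fst b = i \<and> snd b < j) \<and>
          {(i, j), a, b} \<in> neighbourhood_complex ?G \<and> {(i, j), b, (1, j - 1)} \<in> neighbourhood_complex ?G"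
        if a: "a \<in> pverts ?G" "fst a < i \<or> fst a = i \<and> snd a < j" "{(i, j), a} \<in> neighbourhood_complex ?G" for a
      proof (rule bexI[of _ a])
        have "{(i, j), a, (1, j - 1)} \<in> neighbourhood_complex ?G"
          using triple[of "snd a" "fst a"] a i by (auto simp: verts)
        then show "(fst a < i \<or> fst a = i \<and> snd a < j) \<and>
          {(i, j), a, a} \<in> neighbourhood_complex ?G \<and> {(i, j), a, (1, j - 1)} \<in> neighbourhood_complex ?G"
          using a by simp
      qed (fact a)
    qed (use h edge i ij in \<open>auto simp: verts\<close>)
  next
    case i: False
    define j' where "j' = (if j = 1 then 2 else j - 1)"
    have j': "1 \<le> j'" "j' \<le> q" "j' = j + 1 \<or> j = j' + 1"
      using pq ij by (auto simp: j'_def verts)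
    have ij': "1 < i" "i \<le> p" "1 \<le> j" "j \<le> q"
      using ij i by (auto simp: verts)
    have to_h: "\<exists>b\<in>pverts ?G. (fst b < i \<or> fst b = i \<and> snd b < j) \<and>
        {(i, j), (x, y), b} \<in> neighbourhood_complex ?G \<and> {(i, j), b, (i - 1, j)} \<in> neighbourhood_complex ?G"
      if xy: "(x, y) \<in> pverts ?G" "x < i \<or> x = i \<and> y < j" "{(i, j), (x, y)} \<in> neighbourhood_complex ?G" for x y
    proof -
      obtain k l where kl: "((i, j), (k, l)) \<in> parcs ?G" "((x, y), (k, l)) \<in> parcs ?G"
        using xy by (auto simp: iff)
      \<comment> \<open>A neighbour of \<open>(i, j)\<close> in row \<open>i - 1\<close> or
        \<open>i\<close> is within one step of the hub, so it is adjacent to the hub or equal to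
        it.\<close>
      consider "(k, l) = (i - 1, j)" | "k = i + 1" | "((i - 1, j), (k, l)) \<in> parcs ?G"
        using kl(1) ij' by (fastforce simp: king_arc_iff)
      then show ?thesis
      proof cases
        case 1
        \<comment> \<open>The hub is not its own neighbour. The detour goes over
          \<open>(i - 1, j')\<close> beside it: the hub is the common neighbour for the first
          triple, \<open>(i, j')\<close> for the second.\<close>
        have "{(i, j), (x, y), (i - 1, j')} \<in> neighbourhood_complex ?G"
          using kl 1 ij' j' by (intro mem[of _ "(i - 1, j)"]) (auto simp: king_arc_iff)
        moreover have "{(i, j), (i - 1, j'), (i - 1, j)} \<in> neighbourhood_complex ?G"
          using ij' j' by (intro mem[of _ "(i, j')"]) (auto simp: king_arc_iff)
        ultimately show ?thesis
          using ij' j' by (intro bexI[of _ "(i - 1, j')"]) (auto simp: verts)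
      next
        case 2
        \<comment> \<open>A lower square that reaches row \<open>i + 1\<close> lies in row
          \<open>i\<close>, one or two columns to the left of \<open>(i, j)\<close>, so
          \<open>(i - 1, j - 1)\<close> sees it as well as the hub.\<close>
        have "{(i, j), (x, y), (i - 1, j)} \<in> neighbourhood_complex ?G"
          using kl 2 ij' xy by (intro mem[of _ "(i - 1, j - 1)"]) (auto simp: king_arc_iff)
        then show ?thesis
          using xy by (intro bexI[of _ "(x, y)"]) auto
      next
        case 3
        have "{(i, j), (x, y), (i - 1, j)} \<in> neighbourhood_complex ?G"
          using kl 3 by (intro mem)
        then show ?thesis
          using xy by (intro bexI[of _ "(x, y)"]) auto
      qed
    qed
    have "{(i, j), (i - 1, j), (i - 1, j)} \<in> neighbourhood_complex ?G"
      using ij' j' by (intro mem[of _ "(i, j')"]) (auto simp: king_arc_iff)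
    then have edge: "{(i, j), (i - 1, j)} \<in> neighbourhood_complex ?G"
      by simp
    show ?thesis
    proof (rule bexI[of _ "(i - 1, j)"], intro conjI ballI impI)
      show "\<exists>b\<in>pverts ?G. (fst b < i \<or> fst b = i \<and> snd b < j) \<and>
          {(i, j), a, b} \<in> neighbourhood_complex ?G \<and> {(i, j), b, (i - 1, j)} \<in> neighbourhood_complex ?G"
        if a: "a \<in> pverts ?G" "fst a < i \<or> fst a = i \<and> snd a < j" "{(i, j), a} \<in> neighbourhood_complex ?G" for a
        using to_h[of "fst a" "snd a"] a unfolding prod.collapse by blast
    qed (use edge ij' in \<open>auto simp: verts\<close>)
  qed
qed (use pq in auto)

theorem theorem3p5:
  fixes p q :: nat
  assumes "p \<ge> 2" and "q \<ge> 2"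
  shows "simply_connected_complex (neighbourhood_complex (queen_graph p q)) \<and>
         simply_connected_complex (neighbourhood_complex (king_graph p q))"
  using simply_connected_queen[OF assms] simply_connected_king[OF assms] by blast

end
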